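(* Let $R$ be a commutative semiring, $d\ge 2$ an integer, $\Sigma$ a simplicial complex with vertex set $\Sigma_0$, and let $p=(p_\sigma)_{\sigma\in\Sigma}$ be an $R$-distribution on $(\Sigma,\mathbb{Z}_d)$. Then the simplicial distribution $\mathrm{real}(p):X_\Sigma\to D_R(\Delta_{\mathbb{Z}_d})$ is noncontextual if and only if there exists $\tilde p\in D_R(\mathbb{Z}_d^{\Sigma_0})$ such that $\tilde p|_\sigma=p_\sigma$ for all $\sigma\in\Sigma$.
   Context: For a set $S$, $D_R(S)$ is the set of functions $p:S\to R$ of finite support with $\sum_s p(s)=1$; for $f:S\to T$, $D_R(f)(p)(t)=\sum_{f(s)=t}p(s)$; $\delta^s$ is the delta distribution at $s$. For a simplicial set $Y$, $D_R(Y)$ is obtained by applying $D_R$ degreewise. $\mathbb{Z}_d=\{0,\dots,d-1\}$ is the integers mod $d$. For $V\subseteq U\subseteq\Sigma_0$ and $p\in D_R(\mathbb{Z}_d^U)$, $p|_V\in D_R(\mathbb{Z}_d^V)$ is $D_R$ of the restriction map $\mathbb{Z}_d^U\to\mathbb{Z}_d^V$ applied to $p$. An $R$-distribution on $(\Sigma,\mathbb{Z}_d)$ is a tuple $(p_\sigma)_{\sigma\in\Sigma}$ with $p_\sigma\in D_R(\mathbb{Z}_d^\sigma)$ and $p_\sigma|_{\sigma\cap\sigma'}=p_{\sigma'}|_{\sigma\cap\sigma'}$ for all $\sigma,\sigma'\in\Sigma$. For a set $U$, $\Delta_U$ is the simplicial set with $(\Delta_U)_n=U^{n+1}$, where $d_i$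 deletes the $i$-th entry and $s_j$ repeats the $j$-th entry. $X_\Sigma\subseteq\Delta_{\Sigma_0}$ is the simplicial subset with $(X_\Sigma)_n=\{(x_0,\dots,x_n)\in\Sigma_0^{n+1}:\{x_0,\dots,x_n\}\in\Sigma\}$. The simplicial distribution $\mathrm{real}(p):X_\Sigma\to D_R(\Delta_{\mathbb{Z}_d})$ is defined by $$\mathrm{real}(p)_n(x_0,\dots,x_n)(a_0,\dots,a_n)=p_{\{x_0,\dots,x_n\}}(s:x_i\mapsto a_i),$$ the value being $0$ when $x_i\mapsto a_i$ is not a well-defined function (i.e. $x_i=x_j$ but $a_i\ne a_j$ for some $i,j$). For simplicial sets $X,Y$, $\Theta_{X,Y}:D_R(\mathrm{sSet}(X,Y))\to\mathrm{sSet}(X,D_R(Y))$ is $\Theta_{X,Y}(d)_n(x)=\sum_{\varphi}d(\varphi)\delta^{\varphi_n(x)}$. A simplicial map $X\to D_R(Y)$ is noncontextual if it lies in the image of $\Theta_{X,Y}$. *)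

theory Defs
  imports "HOL-Library.FuncSet"
begin

text \<open>A commutative semiring \<open>R\<close> is a type of sort \<open>{comm_semiring_0, comm_monoid_mult}\<close>. The class
  \<open>comm_semiring_1\<close> would in addition impose \<open>0 \<noteq> 1\<close>.\<close>

section \<open>Distributions\<close>

text \<open>A function \<open>S \<rightarrow> R\<close> is represented by its extension by \<open>0\<close> outside \<open>S\<close>, so that two
  distributions on \<open>S\<close> are equal iff they agree on \<open>S\<close>.\<close>

definition Dist :: "'a set \<Rightarrow> ('a \<Rightarrow> 'r::{comm_semiring_0,comm_monoid_mult}) set" where
  "Dist S = {p. (\<forall>s. s \<notin> S \<longrightarrow> p s = 0) \<and> finite {s. p s \<noteq> 0} \<and> (\<Sum>s | p s \<noteq> 0. p s) = 1}"

text \<open>\<open>D\<^sub>R(f)\<close>. The fibre is cut down to the (finite) support of \<open>p\<close>.\<close>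

definition Dist_map :: "('a \<Rightarrow> 'b) \<Rightarrow> ('a \<Rightarrow> 'r) \<Rightarrow> 'b \<Rightarrow> 'r::{comm_semiring_0,comm_monoid_mult}" where
  "Dist_map f p t = (\<Sum>s | p s \<noteq> 0 \<and> f s = t. p s)"

definition delta :: "'a \<Rightarrow> 'a \<Rightarrow> 'r::{comm_semiring_0,comm_monoid_mult}" where
  "delta s t = (if t = s then 1 else 0)"

lemma Dist_map_eq_sum:
  assumes "finite A" "{s. p s \<noteq> 0} \<subseteq> A"
  shows "Dist_map f p t = (\<Sum>s\<in>A. if f s = t then p s else 0)"
proof -
  have "(\<Sum>s\<in>A. if f s = t then p s else 0) = (\<Sum>s\<in>{s. p s \<noteq> 0 \<and> f s = t}. p s)"
    using assms by (intro sum.mono_neutral_cong_right) auto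
  then show ?thesis by (simp add: Dist_map_def)
qed

lemma Dist_map_nonzero: "Dist_map f p t \<noteq> 0 \<Longrightarrow> \<exists>s. p s \<noteq> 0 \<and> f s = t"
  unfolding Dist_map_def by (metis (mono_tags, lifting) mem_Collect_eq sum.neutral)

lemma Dist_map_in_Dist:
  assumes p: "p \<in> Dist S" and f: "\<And>s. s \<in> S \<Longrightarrow> f s \<in> T"
  shows "Dist_map f p \<in> Dist T"
proof -
  let ?A = "{s. p s \<noteq> 0}"
  have A: "finite ?A" "?A \<subseteq> S" and one: "sum p ?A = 1"
    using p by (auto simp: Dist_def)
  have sub: "{t. Dist_map f p t \<noteq> 0} \<subseteq> f ` ?A"
    using Dist_map_nonzero by fastforce
  have "(\<Sum>t | Dist_map f p t \<noteq> 0. Dist_map f p t) = (\<Sum>t\<in>f ` ?A. Dist_map f p t)"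
    using sub A by (intro sum.mono_neutral_left) auto
  also have "\<dots> = (\<Sum>t\<in>f ` ?A. \<Sum>s\<in>?A. if f s = t then p s else 0)"
    using A by (simp add: Dist_map_eq_sum[OF _ subset_refl])
  also have "\<dots> = (\<Sum>s\<in>?A. \<Sum>t\<in>f ` ?A. if f s = t then p s else 0)"
    by (rule sum.swap)
  also have "\<dots> = sum p ?A"
    using A by (intro sum.cong) (auto simp: sum.delta')
  finally have "(\<Sum>t | Dist_map f p t \<noteq> 0. Dist_map f p t) = 1" using one by simp
  moreover have "finite {t. Dist_map f p t \<noteq> 0}"
    using sub A finite_subset by blast
  moreover have "Dist_map f p t = 0" if "t \<notin> T" for t
    using Dist_map_nonzero[of f p t] A f that by blast
  ultimately show ?thesis by (simp add: Dist_def)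
qed

lemma Dist_map_cong:
  assumes "p \<in> Dist S" and "\<And>s. s \<in> S \<Longrightarrow> f s = g s"
  shows "Dist_map f p = Dist_map g p"
proof
  fix t
  have "p s \<noteq> 0 \<Longrightarrow> s \<in> S" for s using assms(1) by (auto simp: Dist_def)
  then have "{s. p s \<noteq> 0 \<and> f s = t} = {s. p s \<noteq> 0 \<and> g s = t}"
    using assms(2) by auto
  then show "Dist_map f p t = Dist_map g p t" by (simp add: Dist_map_def)
qed

lemma Dist_map_comp:
  assumes p: "p \<in> Dist S"
  shows "Dist_map g (Dist_map f p) = Dist_map (\<lambda>s. g (f s)) p"
proof
  fix u
  let ?A = "{s. p s \<noteq> 0}"
  have A: "finite ?A" using p by (auto simp: Dist_def)
  have sub: "{t. Dist_map f p t \<noteq> 0} \<subseteq> f ` ?A"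
    using Dist_map_nonzero by fastforce
  have "Dist_map g (Dist_map f p) u
      = (\<Sum>t\<in>f ` ?A. if g t = u then (\<Sum>s\<in>?A. if f s = t then p s else 0) else 0)"
    unfolding Dist_map_eq_sum[OF finite_imageI[OF A] sub]
    by (simp only: Dist_map_eq_sum[OF A subset_refl])
  also have "\<dots> = (\<Sum>t\<in>f ` ?A. \<Sum>s\<in>?A. if f s = t then (if g (f s) = u then p s else 0) else 0)"
    by (intro sum.cong) (auto intro!: sum.cong sum.neutral)
  also have "\<dots> = (\<Sum>s\<in>?A. \<Sum>t\<in>f ` ?A. if f s = t then (if g (f s) = u then p s else 0) else 0)"
    by (rule sum.swap)
  also have "\<dots> = (\<Sum>s\<in>?A. if g (f s) = u then p s else 0)"
    using A by (intro sum.cong) (auto simp: sum.delta')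
  also have "\<dots> = Dist_map (\<lambda>s. g (f s)) p u"
    by (simp add: Dist_map_eq_sum[OF A subset_refl])
  finally show "Dist_map g (Dist_map f p) u = Dist_map (\<lambda>s. g (f s)) p u" .
qed

lemma Dist_map_id:
  assumes "p \<in> Dist S"
  shows "Dist_map (\<lambda>s. s) p = p"
proof
  fix t
  have "{s. p s \<noteq> 0 \<and> s = t} = (if p t = 0 then {} else {t})" by auto
  then show "Dist_map (\<lambda>s. s) p t = p t" by (simp add: Dist_map_def)
qed

lemma Dist_map_ident:
  assumes "p \<in> Dist S" and "\<And>s. s \<in> S \<Longrightarrow> f s = s"
  shows "Dist_map f p = p"
  using Dist_map_cong[of p S f "\<lambda>s. s"] Dist_map_id[of p S] assms by simp


section \<open>Simplicial sets\<close>

text \<open>\<open>face X n i\<close> is \<open>d\<^sub>i : X\<^sub>n \<rightarrow> X\<^sub>n\<^sub>-\<^sub>1\<close> (meaningful for \<open>n \<ge> 1\<close>, \<open>i \<le> n\<close>), and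
  \<open>degen X n j\<close> is \<open>s\<^sub>j : X\<^sub>n \<rightarrow> X\<^sub>n\<^sub>+\<^sub>1\<close> (meaningful for \<open>j \<le> n\<close>).\<close>

record 'a sset =
  simps :: "nat \<Rightarrow> 'a set"
  face :: "nat \<Rightarrow> nat \<Rightarrow> 'a \<Rightarrow> 'a"
  degen :: "nat \<Rightarrow> nat \<Rightarrow> 'a \<Rightarrow> 'a"

definition simplicial_set :: "'a sset \<Rightarrow> bool" where
  "simplicial_set X \<longleftrightarrow>
    (\<forall>n. \<forall>i \<le> Suc n. \<forall>x \<in> simps X (Suc n). face X (Suc n) i x \<in> simps X n) \<and>
    (\<forall>n. \<forall>j \<le> n. \<forall>x \<in> simps X n. degen X n j x \<in> simps X (Suc n)) \<and>
    (\<forall>n i j. i < j \<longrightarrow> j \<le> Suc (Suc n) \<longrightarrow> (\<forall>x \<in> simps X (Suc (Suc n)).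
       face X (Suc n) i (face X (Suc (Suc n)) j x)
       = face X (Suc n) (j - 1) (face X (Suc (Suc n)) i x))) \<and>
    (\<forall>n i j. i < j \<longrightarrow> j \<le> Suc n \<longrightarrow> (\<forall>x \<in> simps X (Suc n).
       face X (Suc (Suc n)) i (degen X (Suc n) j x) = degen X n (j - 1) (face X (Suc n) i x))) \<and>
    (\<forall>n j. j \<le> n \<longrightarrow> (\<forall>x \<in> simps X n.
       face X (Suc n) j (degen X n j x) = x \<and> face X (Suc n) (Suc j) (degen X n j x) = x)) \<and>
    (\<forall>n i j. Suc j < i \<longrightarrow> i \<le> Suc (Suc n) \<longrightarrow> (\<forall>x \<in> simps X (Suc n).
       face X (Suc (Suc n)) i (degen X (Suc n) j x) = degen X n j (face X (Suc n) (i - 1) x))) \<and>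
    (\<forall>n i j. i \<le> j \<longrightarrow> j \<le> n \<longrightarrow> (\<forall>x \<in> simps X n.
       degen X (Suc n) i (degen X n j x) = degen X (Suc n) (Suc j) (degen X n i x)))"

lemma simplicial_set_face:
  "simplicial_set X \<Longrightarrow> i \<le> Suc n \<Longrightarrow> x \<in> simps X (Suc n) \<Longrightarrow> face X (Suc n) i x \<in> simps X n"
  by (simp add: simplicial_set_def)

lemma simplicial_set_degen:
  "simplicial_set X \<Longrightarrow> j \<le> n \<Longrightarrow> x \<in> simps X n \<Longrightarrow> degen X n j x \<in> simps X (Suc n)"
  by (simp add: simplicial_set_def)

text \<open>\<open>sSet(X, Y)\<close>. The components are extensional functions, so each simplicial map has exactly
  one representative; this matters for distributions on \<open>sSet(X, Y)\<close>.\<close>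

definition sSet :: "'a sset \<Rightarrow> 'b sset \<Rightarrow> (nat \<Rightarrow> 'a \<Rightarrow> 'b) set" where
  "sSet X Y = {\<phi>.
    (\<forall>n. \<phi> n \<in> simps X n \<rightarrow>\<^sub>E simps Y n) \<and>
    (\<forall>n. \<forall>i \<le> Suc n. \<forall>x \<in> simps X (Suc n).
       \<phi> n (face X (Suc n) i x) = face Y (Suc n) i (\<phi> (Suc n) x)) \<and>
    (\<forall>n. \<forall>j \<le> n. \<forall>x \<in> simps X n.
       \<phi> (Suc n) (degen X n j x) = degen Y n j (\<phi> n x))}"

definition Dist_sset :: "'a sset \<Rightarrow> ('a \<Rightarrow> 'r::{comm_semiring_0,comm_monoid_mult}) sset" where
  "Dist_sset Y =
    \<lparr>simps = (\<lambda>n. Dist (simps Y n)),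
     face = (\<lambda>n i. Dist_map (face Y n i)),
     degen = (\<lambda>n j. Dist_map (degen Y n j))\<rparr>"

definition Theta :: "'a sset \<Rightarrow> 'b sset \<Rightarrow> ((nat \<Rightarrow> 'a \<Rightarrow> 'b) \<Rightarrow> 'r::{comm_semiring_0,comm_monoid_mult})
    \<Rightarrow> nat \<Rightarrow> 'a \<Rightarrow> 'b \<Rightarrow> 'r" where
  "Theta X Y q n = (\<lambda>x\<in>simps X n. \<lambda>y. \<Sum>\<phi> | q \<phi> \<noteq> 0. q \<phi> * delta (\<phi> n x) y)"

definition noncontextual ::
  "'a sset \<Rightarrow> 'b sset \<Rightarrow> (nat \<Rightarrow> 'a \<Rightarrow> 'b \<Rightarrow> 'r::{comm_semiring_0,comm_monoid_mult}) \<Rightarrow> bool" where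
  "noncontextual X Y f \<longleftrightarrow> f \<in> sSet X (Dist_sset Y) \<and> f \<in> Theta X Y ` Dist (sSet X Y)"

lemma simplicial_set_Dist_sset:
  fixes Y :: "'a sset"
  assumes Y: "simplicial_set Y"
  shows "simplicial_set (Dist_sset Y :: ('a \<Rightarrow> 'r::{comm_semiring_0,comm_monoid_mult}) sset)"
proof -
  have comp: "Dist_map g (Dist_map f x) = Dist_map g' (Dist_map f' x)"
    if "x \<in> Dist S" "\<And>s. s \<in> S \<Longrightarrow> g (f s) = g' (f' s)"
    for f :: "'a \<Rightarrow> 'a" and g f' g' :: "'a \<Rightarrow> 'a" and x :: "'a \<Rightarrow> 'r" and S
    using that unfolding Dist_map_comp[OF that(1)] by (rule Dist_map_cong)
  have ident: "Dist_map g (Dist_map f x) = x"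
    if "x \<in> Dist S" "\<And>s. s \<in> S \<Longrightarrow> g (f s) = s"
    for f g :: "'a \<Rightarrow> 'a" and x :: "'a \<Rightarrow> 'r" and S
    using that unfolding Dist_map_comp[OF that(1)] by (rule Dist_map_ident)
  note Y' = Y[unfolded simplicial_set_def]
  show ?thesis
    unfolding simplicial_set_def Dist_sset_def sset.simps
    apply (intro conjI allI impI ballI)
           apply (erule Dist_map_in_Dist, simp only: Y'[THEN conjunct1, rule_format])
          apply (erule Dist_map_in_Dist, simp only: Y'[THEN conjunct2, THEN conjunct1, rule_format])
         apply (erule comp, rule Y'[THEN conjunct2, THEN conjunct2, THEN conjunct1, rule_format]; assumption)
        apply (erule comp, rule Y'[THEN conjunct2, THEN conjunct2, THEN conjunct2, THEN conjunct1, rule_format]; assumption)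
       apply (erule ident, rule Y'[THEN conjunct2, THEN conjunct2, THEN conjunct2, THEN conjunct2, THEN conjunct1, rule_format, THEN conjunct1]; assumption)
      apply (erule ident, rule Y'[THEN conjunct2, THEN conjunct2, THEN conjunct2, THEN conjunct2, THEN conjunct1, rule_format, THEN conjunct2]; assumption)
     apply (erule comp, rule Y'[THEN conjunct2, THEN conjunct2, THEN conjunct2, THEN conjunct2, THEN conjunct2, THEN conjunct1, rule_format]; assumption)
    apply (erule comp, rule Y'[THEN conjunct2, THEN conjunct2, THEN conjunct2, THEN conjunct2, THEN conjunct2, THEN conjunct2, rule_format]; assumption)
    done
qed

text \<open>An element \<open>(x\<^sub>0, \<dots>, x\<^sub>n)\<close> of \<open>U\<^sup>n\<^sup>+\<^sup>1\<close> is a list of length \<open>n + 1\<close>.\<close>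

definition delete_nth :: "nat \<Rightarrow> 'a list \<Rightarrow> 'a list" where
  "delete_nth i xs = take i xs @ drop (Suc i) xs"

definition repeat_nth :: "nat \<Rightarrow> 'a list \<Rightarrow> 'a list" where
  "repeat_nth j xs = take (Suc j) xs @ drop j xs"

definition Delta :: "'a set \<Rightarrow> 'a list sset" where
  "Delta U =
    \<lparr>simps = (\<lambda>n. {xs. length xs = Suc n \<and> set xs \<subseteq> U}),
     face = (\<lambda>n. delete_nth),
     degen = (\<lambda>n. repeat_nth)\<rparr>"

lemma length_delete_nth [simp]: "i < length xs \<Longrightarrow> length (delete_nth i xs) = length xs - 1"
  by (simp add: delete_nth_def)

lemma length_repeat_nth [simp]: "j < length xs \<Longrightarrow> length (repeat_nth j xs) = Suc (length xs)"
  by (simp add: repeat_nth_def)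

lemma set_delete_nth: "set (delete_nth i xs) \<subseteq> set xs"
  using set_take_subset[of i xs] set_drop_subset[of "Suc i" xs] by (simp add: delete_nth_def)

lemma set_repeat_nth: "set (repeat_nth j xs) = set xs"
proof -
  have "set xs = set (take j xs) \<union> set (drop j xs)" by (metis append_take_drop_id set_append)
  moreover have "set (take j xs) \<subseteq> set (take (Suc j) xs)" by (simp add: set_take_subset_set_take)
  ultimately show ?thesis
    using set_take_subset[of "Suc j" xs] by (auto simp: repeat_nth_def)
qed

lemma map_delete_nth: "map s (delete_nth i xs) = delete_nth i (map s xs)"
  by (simp add: delete_nth_def take_map drop_map)

lemma map_repeat_nth: "map s (repeat_nth j xs) = repeat_nth j (map s xs)"
  by (simp add: repeat_nth_def take_map drop_map)

lemma nth_delete_nth: "i < length xs \<Longrightarrow> k < length xs - 1 \<Longrightarrow>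
    delete_nth i xs ! k = (if k < i then xs ! k else xs ! Suc k)"
  by (auto simp: delete_nth_def nth_append min_def)

lemma nth_repeat_nth: "j < length xs \<Longrightarrow> k < Suc (length xs) \<Longrightarrow>
    repeat_nth j xs ! k = (if k \<le> j then xs ! k else xs ! (k - 1))"
  by (cases "k \<le> j"; cases "k = Suc j"; cases "length xs = Suc j") (auto simp: repeat_nth_def nth_append min_def)

lemma delete_delete_nth: "i < j \<Longrightarrow> j < length xs \<Longrightarrow>
    delete_nth i (delete_nth j xs) = delete_nth (j - 1) (delete_nth i xs)"
  by (rule nth_equalityI) (auto simp: nth_delete_nth)

lemma delete_repeat_nth_less: "i < j \<Longrightarrow> j < length xs \<Longrightarrow>
    delete_nth i (repeat_nth j xs) = repeat_nth (j - 1) (delete_nth i xs)"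
  by (rule nth_equalityI) (auto simp: nth_delete_nth nth_repeat_nth)

lemma delete_repeat_nth_same: "j < length xs \<Longrightarrow> delete_nth j (repeat_nth j xs) = xs"
  by (rule nth_equalityI) (auto simp: nth_delete_nth nth_repeat_nth)

lemma delete_repeat_nth_Suc: "j < length xs \<Longrightarrow> delete_nth (Suc j) (repeat_nth j xs) = xs"
  by (rule nth_equalityI) (auto simp: nth_delete_nth nth_repeat_nth)

lemma delete_repeat_nth_greater: "Suc j < i \<Longrightarrow> i \<le> length xs \<Longrightarrow>
    delete_nth i (repeat_nth j xs) = repeat_nth j (delete_nth (i - 1) xs)"
  by (rule nth_equalityI) (auto simp: nth_delete_nth nth_repeat_nth)

lemma repeat_repeat_nth: "i \<le> j \<Longrightarrow> j < length xs \<Longrightarrow>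
    repeat_nth i (repeat_nth j xs) = repeat_nth (Suc j) (repeat_nth i xs)"
  by (rule nth_equalityI) (auto simp: nth_repeat_nth)


section \<open>Simplicial complexes and distributions on them\<close>

text \<open>Simplices are finite and nonempty, every vertex is a simplex; \<open>V\<close> may be infinite.\<close>

definition simplicial_complex :: "'v set \<Rightarrow> 'v set set \<Rightarrow> bool" where
  "simplicial_complex V \<Sigma> \<longleftrightarrow>
    (\<forall>\<sigma>\<in>\<Sigma>. finite \<sigma> \<and> \<sigma> \<noteq> {} \<and> \<sigma> \<subseteq> V) \<and>
    (\<forall>v\<in>V. {v} \<in> \<Sigma>) \<and>
    (\<forall>\<sigma>\<in>\<Sigma>. \<forall>\<tau>. \<tau> \<subseteq> \<sigma> \<longrightarrow> \<tau> \<noteq> {} \<longrightarrow> \<tau> \<in> \<Sigma>)"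

definition Zmod :: "nat \<Rightarrow> nat set" where
  "Zmod d = {..<d}"

definition restrict_dist :: "'v set \<Rightarrow> (('v \<Rightarrow> nat) \<Rightarrow> 'r) \<Rightarrow> ('v \<Rightarrow> nat) \<Rightarrow> 'r::{comm_semiring_0,comm_monoid_mult}" where
  "restrict_dist V = Dist_map (\<lambda>s. restrict s V)"

text \<open>Only the values \<open>p \<sigma>\<close> for \<open>\<sigma> \<in> \<Sigma>\<close> are meaningful. The set \<open>\<int>\<^sub>d\<^sup>\<sigma>\<close> is \<open>\<sigma> \<rightarrow>\<^sub>E Zmod d\<close>.\<close>

definition R_distribution ::
  "'v set set \<Rightarrow> nat \<Rightarrow> ('v set \<Rightarrow> ('v \<Rightarrow> nat) \<Rightarrow> 'r::{comm_semiring_0,comm_monoid_mult}) \<Rightarrow> bool" where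
  "R_distribution \<Sigma> d p \<longleftrightarrow>
    (\<forall>\<sigma>\<in>\<Sigma>. p \<sigma> \<in> Dist (\<sigma> \<rightarrow>\<^sub>E Zmod d)) \<and>
    (\<forall>\<sigma>\<in>\<Sigma>. \<forall>\<sigma>'\<in>\<Sigma>. restrict_dist (\<sigma> \<inter> \<sigma>') (p \<sigma>) = restrict_dist (\<sigma> \<inter> \<sigma>') (p \<sigma>'))"

definition X_complex :: "'v set \<Rightarrow> 'v set set \<Rightarrow> 'v list sset" where
  "X_complex V \<Sigma> = (Delta V)\<lparr>simps := \<lambda>n. {xs \<in> simps (Delta V) n. set xs \<in> \<Sigma>}\<rparr>"

text \<open>The equation \<open>map s xs = as\<close> says that \<open>s\<close> is the function \<open>x\<^sub>i \<mapsto> a\<^sub>i\<close>; it has at most one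
  solution \<open>s\<close> in \<open>set xs \<rightarrow>\<^sub>E Zmod d\<close>, and none exactly when \<open>x\<^sub>i \<mapsto> a\<^sub>i\<close> is not well defined
  (for \<open>as\<close> in \<open>\<int>\<^sub>d\<^sup>n\<^sup>+\<^sup>1\<close>; elsewhere the value is \<open>0\<close> by the representation of distributions).\<close>

definition real_dist ::
  "'v set \<Rightarrow> 'v set set \<Rightarrow> nat \<Rightarrow> ('v set \<Rightarrow> ('v \<Rightarrow> nat) \<Rightarrow> 'r)
    \<Rightarrow> nat \<Rightarrow> 'v list \<Rightarrow> nat list \<Rightarrow> 'r::{comm_semiring_0,comm_monoid_mult}" where
  "real_dist V \<Sigma> d p n = (\<lambda>xs\<in>simps (X_complex V \<Sigma>) n. \<lambda>as.
    if \<exists>s \<in> set xs \<rightarrow>\<^sub>E Zmod d. map s xs = as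
    then p (set xs) (THE s. s \<in> set xs \<rightarrow>\<^sub>E Zmod d \<and> map s xs = as)
    else 0)"

lemma simplicial_set_Delta: "simplicial_set (Delta U)"
proof -
  have "set (delete_nth i xs) \<subseteq> U" if "set xs \<subseteq> U" for i xs
    using that set_delete_nth by fast
  then show ?thesis
    unfolding simplicial_set_def Delta_def sset.simps
    apply (intro conjI allI impI ballI; clarsimp simp del: One_nat_def)
    subgoal by (auto simp: set_repeat_nth)
    subgoal by (rule delete_delete_nth) simp_all
    subgoal by (rule delete_repeat_nth_less) simp_all
    subgoal by (rule delete_repeat_nth_same) simp
    subgoal by (rule delete_repeat_nth_Suc) simp
    subgoal by (rule delete_repeat_nth_greater) simp_all
    subgoal by (rule repeat_repeat_nth) simp_all
    done
qed

text \<open>A subset of a simplicial set closed under the operators is a simplicial set.\<close>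

lemma simplicial_set_subset:
  assumes X: "simplicial_set X"
    and sub: "\<And>n. A n \<subseteq> simps X n"
    and face: "\<And>n i x. i \<le> Suc n \<Longrightarrow> x \<in> A (Suc n) \<Longrightarrow> face X (Suc n) i x \<in> A n"
    and degen: "\<And>n j x. j \<le> n \<Longrightarrow> x \<in> A n \<Longrightarrow> degen X n j x \<in> A (Suc n)"
  shows "simplicial_set (X\<lparr>simps := A\<rparr>)"
proof -
  note X' = X[unfolded simplicial_set_def]
  have inX: "x \<in> A n \<Longrightarrow> x \<in> simps X n" for x n using sub by blast
  have upd: "simps (X\<lparr>simps := A\<rparr>) = A" "sset.face (X\<lparr>simps := A\<rparr>) = sset.face X"
    "sset.degen (X\<lparr>simps := A\<rparr>) = sset.degen X" by simp_all
  show ?thesis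
    unfolding simplicial_set_def upd
    apply (intro conjI allI impI ballI)
           apply (erule (1) face)
          apply (erule (1) degen)
         apply (drule inX, rule X'[THEN conjunct2, THEN conjunct2, THEN conjunct1, rule_format]; assumption)
        apply (drule inX, rule X'[THEN conjunct2, THEN conjunct2, THEN conjunct2, THEN conjunct1, rule_format]; assumption)
       apply (drule inX, rule X'[THEN conjunct2, THEN conjunct2, THEN conjunct2, THEN conjunct2, THEN conjunct1, rule_format, THEN conjunct1]; assumption)
      apply (drule inX, rule X'[THEN conjunct2, THEN conjunct2, THEN conjunct2, THEN conjunct2, THEN conjunct1, rule_format, THEN conjunct2]; assumption)
     apply (drule inX, rule X'[THEN conjunct2, THEN conjunct2, THEN conjunct2, THEN conjunct2, THEN conjunct2, THEN conjunct1, rule_format]; assumption)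
    apply (drule inX, rule X'[THEN conjunct2, THEN conjunct2, THEN conjunct2, THEN conjunct2, THEN conjunct2, THEN conjunct2, rule_format]; assumption)
    done
qed

lemma simplicial_set_X_complex:
  assumes "simplicial_complex V \<Sigma>"
  shows "simplicial_set (X_complex V \<Sigma>)"
  unfolding X_complex_def
proof (rule simplicial_set_subset[OF simplicial_set_Delta])
  fix n i xs
  assume i: "i \<le> Suc n" and xs: "xs \<in> {xs \<in> simps (Delta V) (Suc n). set xs \<in> \<Sigma>}"
  have len: "length (delete_nth i xs) = Suc n" using i xs by (simp add: Delta_def)
  then have "set (delete_nth i xs) \<noteq> {}" by auto
  moreover have "set xs \<in> \<Sigma>" using xs by simp
  ultimately have "set (delete_nth i xs) \<in> \<Sigma>"
    using assms set_delete_nth[of i xs] by (simp add: simplicial_complex_def)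
  moreover have "set (delete_nth i xs) \<subseteq> V"
    using xs by (intro subset_trans[OF set_delete_nth]) (simp add: Delta_def)
  ultimately show "face (Delta V) (Suc n) i xs \<in> {xs \<in> simps (Delta V) n. set xs \<in> \<Sigma>}"
    using len by (simp add: Delta_def)
next
  fix n j xs
  assume "j \<le> n" "xs \<in> {xs \<in> simps (Delta V) n. set xs \<in> \<Sigma>}"
  then show "degen (Delta V) n j xs \<in> {xs \<in> simps (Delta V) (Suc n). set xs \<in> \<Sigma>}"
    by (simp add: Delta_def set_repeat_nth)
qed (rule Collect_restrict)

lemma real_dist_eq_Dist_map:
  assumes "p (set xs) \<in> Dist (set xs \<rightarrow>\<^sub>E Zmod d)" and "xs \<in> simps (X_complex V \<Sigma>) n"
  shows "real_dist V \<Sigma> d p n xs = Dist_map (\<lambda>s. map s xs) (p (set xs))"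
proof
  fix as
  let ?F = "set xs \<rightarrow>\<^sub>E Zmod d"
  have inj: "s = s'" if "s \<in> ?F" "s' \<in> ?F" "map s xs = map s' xs" for s s'
    using that by (intro PiE_ext[of s "set xs" "\<lambda>_. Zmod d"]) auto
  have supp: "s \<in> ?F" if "p (set xs) s \<noteq> 0" for s using assms(1) that by (auto simp: Dist_def)
  show "real_dist V \<Sigma> d p n xs as = Dist_map (\<lambda>s. map s xs) (p (set xs)) as"
  proof (cases "\<exists>s\<in>?F. map s xs = as")
    case True
    then obtain s where s: "s \<in> ?F" "map s xs = as" by blast
    have the: "(THE s. s \<in> ?F \<and> map s xs = as) = s" using s inj by (intro the_equality) auto
    have eq: "t = s" if "p (set xs) t \<noteq> 0" "map t xs = as" for t
      using inj[OF supp s(1)] s that by simp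
    have fibre: "{t. p (set xs) t \<noteq> 0 \<and> map t xs = as} = (if p (set xs) s = 0 then {} else {s})"
    proof (rule set_eqI)
      fix t
      show "t \<in> {t. p (set xs) t \<noteq> 0 \<and> map t xs = as}
          \<longleftrightarrow> t \<in> (if p (set xs) s = 0 then {} else {s})"
        using eq[of t] s(2) by (cases "t = s") (simp, simp, blast)
    qed
    have "real_dist V \<Sigma> d p n xs as = p (set xs) s"
      using assms(2) True by (simp only: real_dist_def restrict_apply if_True the)
    also have "\<dots> = Dist_map (\<lambda>s. map s xs) (p (set xs)) as"
      unfolding Dist_map_def fibre by simp
    finally show ?thesis .
  next
    case False
    then have e: "{t. p (set xs) t \<noteq> 0 \<and> map t xs = as} = {}" using supp by auto
    have "Dist_map (\<lambda>s. map s xs) (p (set xs)) as = 0" unfolding Dist_map_def e by simp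
    then show ?thesis using assms(2) False by (simp add: real_dist_def)
  qed
qed

lemma real_dist_in_sSet:
  fixes p :: "'v set \<Rightarrow> ('v \<Rightarrow> nat) \<Rightarrow> 'r::{comm_semiring_0,comm_monoid_mult}"
  assumes C: "simplicial_complex V \<Sigma>" and p: "R_distribution \<Sigma> d p"
  shows "real_dist V \<Sigma> d p \<in> sSet (X_complex V \<Sigma>) (Dist_sset (Delta (Zmod d)))"
proof -
  let ?X = "X_complex V \<Sigma>"
  have X: "simplicial_set ?X" using C by (rule simplicial_set_X_complex)
  have inD: "p (set xs) \<in> Dist (set xs \<rightarrow>\<^sub>E Zmod d)" if "xs \<in> simps ?X n" for xs n
    using that p by (auto simp: R_distribution_def X_complex_def)
  have op: "real_dist V \<Sigma> d p m ys = Dist_map h (real_dist V \<Sigma> d p n xs)"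
    if xs: "xs \<in> simps ?X n" and ys: "ys \<in> simps ?X m" and sub: "set ys \<subseteq> set xs"
      and nat: "\<And>s :: 'v \<Rightarrow> nat. map s ys = h (map s xs)"
    for xs n ys m h
  proof -
    have "set xs \<in> \<Sigma>" "set ys \<in> \<Sigma>" using xs ys by (auto simp: X_complex_def)
    then have "restrict_dist (set ys) (p (set xs)) = restrict_dist (set ys) (p (set ys))"
      using p sub unfolding R_distribution_def by (metis inf.absorb2)
    also have "\<dots> = p (set ys)"
      unfolding restrict_dist_def using inD[OF ys]
      by (rule Dist_map_ident) (auto simp: PiE_restrict)
    finally have r: "p (set ys) = Dist_map (\<lambda>s. restrict s (set ys)) (p (set xs))"
      by (simp add: restrict_dist_def)
    have m: "map (restrict s (set ys)) ys = h (map s xs)" for s :: "'v \<Rightarrow> nat"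
      unfolding nat[symmetric] by simp
    show ?thesis
      unfolding real_dist_eq_Dist_map[where p=p, OF inD[OF ys] ys] real_dist_eq_Dist_map[where p=p, OF inD[OF xs] xs]
        Dist_map_comp[OF inD[OF xs]]
      by (subst r, subst Dist_map_comp[OF inD[OF xs]]) (simp only: m)
  qed
  have "real_dist V \<Sigma> d p n \<in> simps ?X n \<rightarrow>\<^sub>E Dist (simps (Delta (Zmod d)) n)" for n
  proof (rule PiE_I)
    fix xs assume xs: "xs \<in> simps ?X n"
    show "real_dist V \<Sigma> d p n xs \<in> Dist (simps (Delta (Zmod d)) n)"
      unfolding real_dist_eq_Dist_map[where p=p, OF inD[OF xs] xs] using inD[OF xs]
      by (rule Dist_map_in_Dist) (use xs in \<open>auto simp: X_complex_def Delta_def\<close>)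
  qed (simp add: real_dist_def)
  moreover have "real_dist V \<Sigma> d p n (delete_nth i xs)
      = Dist_map (delete_nth i) (real_dist V \<Sigma> d p (Suc n) xs)"
    if "i \<le> Suc n" "xs \<in> simps ?X (Suc n)" for n i xs
  proof (rule op[OF that(2) _ set_delete_nth map_delete_nth])
    have "face ?X (Suc n) i xs \<in> simps ?X n" using X that by (rule simplicial_set_face)
    then show "delete_nth i xs \<in> simps ?X n" by (simp add: X_complex_def Delta_def)
  qed
  moreover have "real_dist V \<Sigma> d p (Suc n) (repeat_nth j xs)
      = Dist_map (repeat_nth j) (real_dist V \<Sigma> d p n xs)"
    if "j \<le> n" "xs \<in> simps ?X n" for n j xs
  proof (rule op[OF that(2) _ equalityD1[OF set_repeat_nth] map_repeat_nth])
    have "degen ?X n j xs \<in> simps ?X (Suc n)" using X that by (rule simplicial_set_degen)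
    then show "repeat_nth j xs \<in> simps ?X (Suc n)" by (simp add: X_complex_def Delta_def)
  qed
  moreover have "face ?X n = delete_nth" "degen ?X n = repeat_nth"
    "face (Delta (Zmod d)) n = delete_nth" "degen (Delta (Zmod d)) n = repeat_nth" for n
    by (simp_all add: X_complex_def Delta_def)
  ultimately show ?thesis
    unfolding sSet_def by (simp add: Dist_sset_def)
qed

end

theory Submission
  imports Defs
begin

text \<open>A simplicial map \<open>X\<^sub>\<Sigma> \<rightarrow> \<Delta>\<^bsub>\<int>\<^sub>d\<^esub>\<close> is determined by its values on vertices, and these
  can be prescribed freely, so \<open>sSet(X\<^sub>\<Sigma>, \<Delta>\<^bsub>\<int>\<^sub>d\<^esub>)\<close> is in bijection with the functions
  \<open>V \<rightarrow> \<int>\<^sub>d\<close>. Under this bijection \<open>\<Theta>\<close> at a simplex with vertex set \<open>\<sigma>\<close> is the restriction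
  to \<open>\<sigma>\<close>, followed by the injection that lists the values of a function on \<open>\<sigma>\<close>.\<close>

text \<open>Each \<open>delta\<close> factor is 0 or 1, so the sum collapses to the fibre of
  evaluation at \<open>x\<close>. In this form \<Theta> composes with other push-forwards through
  \<open>Dist_map_comp\<close>.\<close>

lemma Theta_eq_Dist_map:
  assumes "q \<in> Dist S" and "x \<in> simps X n"
  shows "Theta X Y q n x = Dist_map (\<lambda>\<phi>. \<phi> n x) q"
proof
  fix y
  have fin: "finite {\<phi>. q \<phi> \<noteq> 0}" using assms(1) by (simp add: Dist_def)
  show "Theta X Y q n x y = Dist_map (\<lambda>\<phi>. \<phi> n x) q y"
    unfolding Dist_map_eq_sum[OF fin subset_refl] using assms(2)
    by (auto simp: Theta_def delta_def intro!: sum.cong)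
qed

text \<open>Cut down to the simplices because \<open>sSet\<close> contains only extensional
  components.\<close>

definition induced_map :: "'v set \<Rightarrow> 'v set set \<Rightarrow> ('v \<Rightarrow> 'a) \<Rightarrow> nat \<Rightarrow> 'v list \<Rightarrow> 'a list" where
  "induced_map V \<Sigma> s n = (\<lambda>xs\<in>simps (X_complex V \<Sigma>) n. map s xs)"

definition vertex_map :: "'v set \<Rightarrow> (nat \<Rightarrow> 'v list \<Rightarrow> 'a list) \<Rightarrow> 'v \<Rightarrow> 'a" where
  "vertex_map V \<phi> = (\<lambda>v\<in>V. hd (\<phi> 0 [v]))"

lemma simps_X_complex:
  "xs \<in> simps (X_complex V \<Sigma>) n \<longleftrightarrow> length xs = Suc n \<and> set xs \<subseteq> V \<and> set xs \<in> \<Sigma>"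
  by (auto simp: X_complex_def Delta_def)

lemma face_X_complex [simp]: "face (X_complex V \<Sigma>) n = delete_nth"
  and degen_X_complex [simp]: "degen (X_complex V \<Sigma>) n = repeat_nth"
  by (simp_all add: X_complex_def Delta_def)

lemma simps_Delta: "xs \<in> simps (Delta U) n \<longleftrightarrow> length xs = Suc n \<and> set xs \<subseteq> U"
  and face_Delta [simp]: "face (Delta U) n = delete_nth"
  and degen_Delta [simp]: "degen (Delta U) n = repeat_nth"
  by (simp_all add: Delta_def)

lemma induced_map_in_sSet:
  assumes C: "simplicial_complex V \<Sigma>" and s: "s \<in> V \<rightarrow>\<^sub>E U"
  shows "induced_map V \<Sigma> s \<in> sSet (X_complex V \<Sigma>) (Delta U)"
proof -
  let ?X = "X_complex V \<Sigma>"
  note X = simplicial_set_X_complex[OF C]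
  have "induced_map V \<Sigma> s n \<in> simps ?X n \<rightarrow>\<^sub>E simps (Delta U) n" for n
    using s by (fastforce simp: induced_map_def simps_X_complex simps_Delta)
  moreover have "delete_nth i xs \<in> simps ?X n" if "i \<le> Suc n" "xs \<in> simps ?X (Suc n)" for n i xs
    using simplicial_set_face[OF X that] by simp
  moreover have "repeat_nth j xs \<in> simps ?X (Suc n)" if "j \<le> n" "xs \<in> simps ?X n" for n j xs
    using simplicial_set_degen[OF X that] by simp
  ultimately show ?thesis
    by (simp add: sSet_def induced_map_def map_delete_nth map_repeat_nth)
qed

text \<open>Every vertex spans a simplex, so \<open>[v]\<close> is a 0-simplex and its image is a
  one-entry list over \<open>U\<close>.\<close>

lemma vertex_map_in:
  assumes C: "simplicial_complex V \<Sigma>" and \<phi>: "\<phi> \<in> sSet (X_complex V \<Sigma>) (Delta U)"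
  shows "vertex_map V \<phi> \<in> V \<rightarrow>\<^sub>E U"
proof -
  have "hd (\<phi> 0 [v]) \<in> U" if "v \<in> V" for v
  proof -
    have "[v] \<in> simps (X_complex V \<Sigma>) 0"
      using C that by (simp add: simps_X_complex simplicial_complex_def)
    then have "\<phi> 0 [v] \<in> simps (Delta U) 0" using \<phi> by (auto simp: sSet_def)
    then show ?thesis by (auto simp: simps_Delta length_Suc_conv)
  qed
  then show ?thesis by (auto simp: vertex_map_def)
qed

text \<open>With at least two entries, entry 0 survives deleting the last one, and every later entry
  survives, shifted by one, deleting the first.\<close>

lemma delete_ends_eqD:
  assumes len: "length xs = Suc (Suc n)" "length ys = Suc (Suc n)"
    and first: "delete_nth 0 xs = delete_nth 0 ys"
    and last: "delete_nth (Suc n) xs = delete_nth (Suc n) ys"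
  shows "xs = ys"
proof (rule nth_equalityI)
  fix k assume k: "k < length xs"
  show "xs ! k = ys ! k"
  proof (cases k)
    case 0
    then show ?thesis
      using arg_cong[OF last, of "\<lambda>l. l ! 0"] len by (simp add: nth_delete_nth)
  next
    case (Suc j)
    then show ?thesis
      using arg_cong[OF first, of "\<lambda>l. l ! j"] len k by (simp add: nth_delete_nth)
  qed
qed (use len in simp)

text \<open>Induction on the dimension: a simplex of \<open>Delta U\<close> of positive dimension is
  determined by its first and last faces, and \<phi> commutes with faces.\<close>

lemma sSet_eq_map_vertex_map:
  assumes C: "simplicial_complex V \<Sigma>" and \<phi>: "\<phi> \<in> sSet (X_complex V \<Sigma>) (Delta U)"
  shows "xs \<in> simps (X_complex V \<Sigma>) n \<Longrightarrow> \<phi> n xs = map (vertex_map V \<phi>) xs"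
proof (induction n arbitrary: xs)
  case 0
  then obtain v where v: "xs = [v]" "v \<in> V" by (auto simp: simps_X_complex length_Suc_conv)
  have "\<phi> 0 xs \<in> simps (Delta U) 0" using \<phi> 0 by (auto simp: sSet_def)
  then show ?case using v by (auto simp: simps_Delta length_Suc_conv vertex_map_def)
next
  case (Suc n)
  have "\<phi> (Suc n) xs \<in> simps (Delta U) (Suc n)" using \<phi> Suc.prems by (auto simp: sSet_def)
  then have len: "length (\<phi> (Suc n) xs) = Suc (Suc n)" by (simp add: simps_Delta)
  have eq: "delete_nth i (\<phi> (Suc n) xs) = delete_nth i (map (vertex_map V \<phi>) xs)"
    if i: "i \<le> Suc n" for i
  proof -
    \<comment> \<open>The induction hypothesis applies to the face because \<open>X_complex\<close>
      is closed under faces.\<close>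
    have "delete_nth i (\<phi> (Suc n) xs) = \<phi> n (delete_nth i xs)"
      using \<phi> i Suc.prems by (simp add: sSet_def)
    also have "\<dots> = map (vertex_map V \<phi>) (delete_nth i xs)"
      using simplicial_set_face[OF simplicial_set_X_complex[OF C] i Suc.prems]
      by (simp add: Suc.IH)
    finally show ?thesis by (simp add: map_delete_nth)
  qed
  have "length (map (vertex_map V \<phi>) xs) = Suc (Suc n)"
    using Suc.prems by (simp add: simps_X_complex)
  with len show ?case by (rule delete_ends_eqD) (rule eq, simp)+
qed

lemma noncontextual_if_global:
  assumes C: "simplicial_complex V \<Sigma>" and p: "R_distribution \<Sigma> d p"
    and q: "q \<in> Dist (V \<rightarrow>\<^sub>E Zmod d)" and res: "\<And>\<sigma>. \<sigma> \<in> \<Sigma> \<Longrightarrow> restrict_dist \<sigma> q = p \<sigma>"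
  shows "noncontextual (X_complex V \<Sigma>) (Delta (Zmod d)) (real_dist V \<Sigma> d p)"
proof -
  let ?X = "X_complex V \<Sigma>" and ?Y = "Delta (Zmod d)"
  \<comment> \<open>Transport of the global distribution along the bijection from functions on
    \<open>V\<close> to simplicial maps.\<close>
  let ?Q = "Dist_map (induced_map V \<Sigma>) q"
  have Q: "?Q \<in> Dist (sSet ?X ?Y)"
    by (rule Dist_map_in_Dist[OF q induced_map_in_sSet[OF C]])
  have "real_dist V \<Sigma> d p n xs = Theta ?X ?Y ?Q n xs" for n xs
  proof (cases "xs \<in> simps ?X n")
    case True
    then have \<sigma>: "set xs \<in> \<Sigma>" by (simp add: simps_X_complex)
    then have "p (set xs) \<in> Dist (set xs \<rightarrow>\<^sub>E Zmod d)" using p by (simp add: R_distribution_def)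
    then have "real_dist V \<Sigma> d p n xs = Dist_map (\<lambda>s. map s xs) (p (set xs))"
      using True by (rule real_dist_eq_Dist_map)
    also have "\<dots> = Dist_map (\<lambda>s. map s xs) (Dist_map (\<lambda>s. restrict s (set xs)) q)"
      using res[OF \<sigma>] by (simp add: restrict_dist_def)
    \<comment> \<open>Listing values along \<open>xs\<close> only reads \<open>s\<close> on
      \<open>set xs\<close>, so the restriction disappears.\<close>
    also have "\<dots> = Dist_map (\<lambda>s. map s xs) q"
      by (simp add: Dist_map_comp[OF q] cong: map_cong)
    also have "\<dots> = Dist_map (\<lambda>\<phi>. \<phi> n xs) ?Q"
      using True by (simp add: Dist_map_comp[OF q] induced_map_def)
    also have "\<dots> = Theta ?X ?Y ?Q n xs" by (rule Theta_eq_Dist_map[OF Q True, symmetric])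
    finally show ?thesis .
  next
    \<comment> \<open>Off the simplices both sides are \<open>undefined\<close>.\<close>
    case False
    then show ?thesis by (simp add: real_dist_def Theta_def)
  qed
  then have "real_dist V \<Sigma> d p = Theta ?X ?Y ?Q" by blast
  then show ?thesis
    using real_dist_in_sSet[OF C p] Q by (simp add: noncontextual_def)
qed

lemma global_if_noncontextual:
  assumes C: "simplicial_complex V \<Sigma>" and p: "R_distribution \<Sigma> d p"
    and nc: "noncontextual (X_complex V \<Sigma>) (Delta (Zmod d)) (real_dist V \<Sigma> d p)"
  shows "\<exists>q \<in> Dist (V \<rightarrow>\<^sub>E Zmod d). \<forall>\<sigma>\<in>\<Sigma>. restrict_dist \<sigma> q = p \<sigma>"
proof -
  let ?X = "X_complex V \<Sigma>" and ?Y = "Delta (Zmod d)"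
  obtain Q where Q: "Q \<in> Dist (sSet ?X ?Y)" and real: "real_dist V \<Sigma> d p = Theta ?X ?Y Q"
    using nc by (auto simp: noncontextual_def)
  \<comment> \<open>The global distribution records only the vertex values of a random simplicial
    map.\<close>
  let ?q = "Dist_map (vertex_map V) Q"
  have q: "?q \<in> Dist (V \<rightarrow>\<^sub>E Zmod d)"
    by (rule Dist_map_in_Dist[OF Q vertex_map_in[OF C]])
  have "restrict_dist \<sigma> ?q = p \<sigma>" if \<sigma>: "\<sigma> \<in> \<Sigma>" for \<sigma>
  proof -
    have "finite \<sigma>" "\<sigma> \<noteq> {}" "\<sigma> \<subseteq> V" using C \<sigma> by (auto simp: simplicial_complex_def)
    \<comment> \<open>Any enumeration of \<sigma> serves as a simplex with vertex set \<sigma>;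
      repetitions are harmless.\<close>
    then obtain xs where xs: "set xs = \<sigma>" using finite_list by blast
    define n where "n = length xs - 1"
    have xsX: "xs \<in> simps ?X n"
      using xs \<sigma> \<open>\<sigma> \<noteq> {}\<close> \<open>\<sigma> \<subseteq> V\<close> by (cases xs) (auto simp: simps_X_complex n_def)
    have p\<sigma>: "p \<sigma> \<in> Dist (\<sigma> \<rightarrow>\<^sub>E Zmod d)" using p \<sigma> by (simp add: R_distribution_def)
    have marg: "Dist_map (\<lambda>s. map s xs) (p \<sigma>) = Dist_map (\<lambda>s. map s xs) ?q"
    proof -
      have "Dist_map (\<lambda>s. map s xs) (p \<sigma>) = real_dist V \<Sigma> d p n xs"
        using real_dist_eq_Dist_map[OF _ xsX, of p d] p\<sigma> xs by simp
      also have "\<dots> = Dist_map (\<lambda>\<phi>. \<phi> n xs) Q"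
        by (simp add: real Theta_eq_Dist_map[OF Q xsX])
      also have "\<dots> = Dist_map (\<lambda>\<phi>. map (vertex_map V \<phi>) xs) Q"
        using Q sSet_eq_map_vertex_map[OF C _ xsX] by (rule Dist_map_cong)
      finally show ?thesis by (simp add: Dist_map_comp[OF Q])
    qed
    \<comment> \<open>A left inverse of listing values: it rebuilds a function on \<sigma> from its
      values along \<open>xs\<close>. Its value on lists not of the form \<open>map s xs\<close> is
      irrelevant.\<close>
    define g :: "nat list \<Rightarrow> 'a \<Rightarrow> nat" where
      "g as = (\<lambda>v\<in>\<sigma>. the (map_of (zip xs as) v))" for as
    have g: "g (map s xs) = restrict s \<sigma>" for s
      using xs by (auto simp: g_def map_of_zip_map fun_eq_iff)
    \<comment> \<open>The support of \<open>p \<sigma>\<close> consists of extensional functions on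
      \<sigma>, which restriction fixes. Pushing \<open>marg\<close> forward along \<open>g\<close>
      thus gives \<open>p \<sigma>\<close> on one side and the restriction of \<open>?q\<close> on
      the other.\<close>
    have "p \<sigma> = Dist_map g (Dist_map (\<lambda>s. map s xs) (p \<sigma>))"
      unfolding Dist_map_comp[OF p\<sigma>] g
      by (rule Dist_map_ident[OF p\<sigma>, symmetric]) (rule PiE_restrict)
    also have "\<dots> = restrict_dist \<sigma> ?q"
      unfolding marg Dist_map_comp[OF q] g restrict_dist_def ..
    finally show ?thesis ..
  qed
  then show ?thesis using q by blast
qed

theorem theorem2p18:
  fixes d :: nat
    and V :: "'v set"
    and \<Sigma> :: "'v set set"
    and p :: "'v set \<Rightarrow> ('v \<Rightarrow> nat) \<Rightarrow> 'r::{comm_semiring_0,comm_monoid_mult}"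
  assumes "d \<ge> 2"
    and "simplicial_complex V \<Sigma>"
    and "R_distribution \<Sigma> d p"
  shows "noncontextual (X_complex V \<Sigma>) (Delta (Zmod d)) (real_dist V \<Sigma> d p) \<longleftrightarrow>
    (\<exists>q \<in> Dist (V \<rightarrow>\<^sub>E Zmod d). \<forall>\<sigma>\<in>\<Sigma>. restrict_dist \<sigma> q = p \<sigma>)"
  using noncontextual_if_global[OF assms(2,3)] global_if_noncontextual[OF assms(2,3)] by blast

end
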